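(* Let $k\ge 4$ be an integer and let $H$ be a subgraph of the balanced complete $(k-1)$-partite graph $K_{(k-1)\times 2}$. Then $$\operatorname{gr}_k(K_{1,3}:H)=\left\lceil \frac{1+\sqrt{1+8k}}{2}\right\rceil.$$
   Context: All graphs are finite, simple and without isolated vertices (in particular $H$ is non-empty). A $k$-edge-coloring of a graph is a map from its edge set onto $\{1,\dots,k\}$ that is exact, i.e. every one of the $k$ colors is used at least once. An edge-colored graph is rainbow if all its edges have distinct colors and monochromatic if all its edges have the same color. $K_{(m)\times 2}$ denotes the complete $m$-partite graph with every part of size $2$. For non-empty graphs $G,H$ and a positive integer $k$, the Gallai-Ramsey number $\operatorname{gr}_k(G:H)$ is the minimum integer $N$ such that for all $n\ge N$, every (exact) $k$-edge-coloring of $K_n$ contains a rainbow subgraph isomorphic to $G$ or a monochromatic subgraph isomorphic to $H$.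
   Formalization: In the definition of gr_k(G:H), it is additionally required that for every n ≥ N the graph K_n has an exact k-edge-coloring; otherwise small n would qualify vacuously and the stated formula would be false. *)

theory Defs
  imports Complex_Main
begin

type_synonym 'a ugraph = "'a set \<times> 'a set set"

abbreviation verts :: "'a ugraph \<Rightarrow> 'a set" where "verts \<equiv> fst"
abbreviation edges :: "'a ugraph \<Rightarrow> 'a set set" where "edges \<equiv> snd"

definition simple_graph :: "'a ugraph \<Rightarrow> bool" where
  "simple_graph G \<longleftrightarrow> finite (verts G) \<and> (\<forall>e \<in> edges G. e \<subseteq> verts G \<and> card e = 2)"

definition no_isolated_vertices :: "'a ugraph \<Rightarrow> bool" where
  "no_isolated_vertices G \<longleftrightarrow> (\<forall>v \<in> verts G. \<exists>e \<in> edges G. v \<in> e)"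

definition subgraph :: "'a ugraph \<Rightarrow> 'a ugraph \<Rightarrow> bool" where
  "subgraph S G \<longleftrightarrow> simple_graph S \<and> verts S \<subseteq> verts G \<and> edges S \<subseteq> edges G"

definition isomorphic :: "'a ugraph \<Rightarrow> 'b ugraph \<Rightarrow> bool" where
  "isomorphic G H \<longleftrightarrow>
    (\<exists>f. bij_betw f (verts G) (verts H) \<and> (\<lambda>e. f ` e) ` edges G = edges H)"

definition complete_graph :: "nat \<Rightarrow> nat ugraph" where
  "complete_graph n = ({..<n}, {e. e \<subseteq> {..<n} \<and> card e = 2})"

text \<open>The argument lists the part sizes; the vertex \<open>(i, a)\<close> is the \<open>a\<close>-th vertex of part \<open>i\<close>.\<close>

definition complete_multipartite :: "nat list \<Rightarrow> (nat \<times> nat) ugraph" where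
  "complete_multipartite ns =
    (let V = {(i, a). i < length ns \<and> a < ns ! i}
     in (V, {{u, v} | u v. u \<in> V \<and> v \<in> V \<and> fst u \<noteq> fst v}))"

text \<open>Only the values of a coloring on the edge set matter.\<close>

definition exact_edge_coloring :: "nat \<Rightarrow> 'a ugraph \<Rightarrow> ('a set \<Rightarrow> nat) \<Rightarrow> bool" where
  "exact_edge_coloring k G c \<longleftrightarrow> c ` edges G = {1..k}"

definition rainbow :: "('a set \<Rightarrow> nat) \<Rightarrow> 'a ugraph \<Rightarrow> bool" where
  "rainbow c S \<longleftrightarrow> inj_on c (edges S)"

definition monochromatic :: "('a set \<Rightarrow> nat) \<Rightarrow> 'a ugraph \<Rightarrow> bool" where
  "monochromatic c S \<longleftrightarrow> (\<exists>i. \<forall>e \<in> edges S. c e = i)"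

text \<open>
  The existence conjunct makes explicit the usual convention that only those \<open>n\<close> are considered
  for which \<open>K\<^sub>n\<close> has an exact \<open>k\<close>-edge-coloring at all, that is, has at least \<open>k\<close> edges. Without
  it, every smaller \<open>n\<close> would satisfy the condition vacuously, and the trivial lower bound
  \<open>n (n - 1) / 2 \<ge> k\<close> on the Gallai-Ramsey number would fail.
\<close>

definition gallai_ramsey :: "nat \<Rightarrow> 'a ugraph \<Rightarrow> 'b ugraph \<Rightarrow> nat" where
  "gallai_ramsey k G H =
    (LEAST N. \<forall>n\<ge>N.
      (\<exists>c. exact_edge_coloring k (complete_graph n) c) \<and>
      (\<forall>c. exact_edge_coloring k (complete_graph n) c \<longrightarrow>
        (\<exists>S. subgraph S (complete_graph n) \<and> isomorphic S G \<and> rainbow c S) \<or>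
        (\<exists>S. subgraph S (complete_graph n) \<and> isomorphic S H \<and> monochromatic c S)))"

end

theory Submission
  imports Defs
begin

text \<open>
  If no rainbow \<open>K\<^sub>1\<^sub>,\<^sub>3\<close> occurs, every vertex sees at most two colors, and the color sets of any two
  vertices meet in the color of the edge joining them. A pairwise intersecting family of sets of
  size at most two is a star or a triangle; with four or more colors in total it is a star, so all
  vertices see a common color \<open>i\<close>. An edge of each further color \<open>j\<close> then has both ends with color
  set \<open>{i, j}\<close>, so these \<open>k - 1\<close> edges are disjoint and all edges between them have color \<open>i\<close>: their
  ends span a monochromatic \<open>K\<^bsub>(k-1)\<times>2\<^esub>\<close>. Thus the only constraint on \<open>n\<close> is that \<open>K\<^sub>n\<close> has at
  least \<open>k\<close> edges.
\<close>

section \<open>Copies of graphs under injective vertex maps\<close>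

lemma isomorphic_trans:
  assumes "isomorphic G H" "isomorphic H K"
  shows "isomorphic G K"
proof -
  obtain f g where f: "bij_betw f (verts G) (verts H)" "(`) f ` edges G = edges H"
    and g: "bij_betw g (verts H) (verts K)" "(`) g ` edges H = edges K"
    using assms by (auto simp: isomorphic_def)
  have "(`) (g \<circ> f) ` edges G = (`) g ` ((`) f ` edges G)"
    by (simp add: image_image image_comp)
  then show ?thesis
    unfolding isomorphic_def f(2) g(2) using bij_betw_trans[OF f(1) g(1)] by blast
qed

lemma isomorphic_image:
  assumes "inj_on f V" "\<And>e. e \<in> E \<Longrightarrow> e \<subseteq> V"
  shows "isomorphic (f ` V, (`) f ` E) (V, E)"
proof -
  have "inv_into V f ` f ` e = e" if "e \<in> E" for e
    using inv_into_image_cancel[OF assms(1) assms(2)[OF that]] .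
  then have "(`) (inv_into V f) ` (`) f ` E = E"
    by (simp add: image_image)
  moreover have "bij_betw (inv_into V f) (f ` V) V"
    using assms(1) by (simp add: bij_betw_inv_into inj_on_imp_bij_betw)
  ultimately show ?thesis by (auto simp: isomorphic_def)
qed

lemma simple_graph_image:
  assumes "simple_graph S" "inj_on f (verts S)"
  shows "simple_graph (f ` verts S, (`) f ` edges S)"
  using assms unfolding simple_graph_def
  by (auto intro: inj_on_subset simp: card_image) (metis card_image inj_on_subset)

lemma subgraph_complete_graph_iff:
  "subgraph S (complete_graph n) \<longleftrightarrow> simple_graph S \<and> verts S \<subseteq> {..<n}"
  by (auto simp: subgraph_def complete_graph_def simple_graph_def)

lemma simple_complete_multipartite: "simple_graph (complete_multipartite ns)"
proof -
  have "{(i, a). i < length ns \<and> a < ns ! i} = (SIGMA i:{..<length ns}. {..<ns ! i})"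
    by auto
  then have "finite {(i, a). i < length ns \<and> a < ns ! i}" by simp
  then show ?thesis
    by (auto simp: simple_graph_def complete_multipartite_def Let_def card_2_iff)
qed

text \<open>Being rainbow or monochromatic passes to smaller edge sets. The last conclusion
  therefore carries a color property of the image of \<open>G\<close> over to a copy of
  \<open>H\<close> inside it.\<close>

lemma embedded_copy:
  assumes "subgraph S G" "isomorphic S H" "inj_on f (verts G)" "f ` verts G \<subseteq> {..<n}"
  obtains T where "subgraph T (complete_graph n)" "isomorphic T H" "edges T \<subseteq> (`) f ` edges G"
proof
  let ?T = "(f ` verts S, (`) f ` edges S)"
  have S: "simple_graph S" "verts S \<subseteq> verts G" "edges S \<subseteq> edges G"
    using assms(1) by (auto simp: subgraph_def)
  have inj: "inj_on f (verts S)" using assms(3) S(2) inj_on_subset by blast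
  show "subgraph ?T (complete_graph n)"
    using simple_graph_image[OF S(1) inj] S(2) assms(4) by (auto simp: subgraph_complete_graph_iff)
  have "isomorphic ?T (verts S, edges S)"
    using inj S(1) by (intro isomorphic_image) (auto simp: simple_graph_def)
  then show "isomorphic ?T H" using assms(2) isomorphic_trans by fastforce
  show "edges ?T \<subseteq> (`) f ` edges G" using S(3) by auto
qed

section \<open>Colorings without a rainbow star with three edges\<close>

lemma rainbow_star:
  assumes "v < n" "x < n" "y < n" "z < n" "v \<notin> {x, y, z}"
    and "c {v, x} \<noteq> c {v, y}" "c {v, x} \<noteq> c {v, z}" "c {v, y} \<noteq> c {v, z}"
  shows "\<exists>S. subgraph S (complete_graph n) \<and> isomorphic S (complete_multipartite [1, 3])
            \<and> rainbow c S"
proof -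
  let ?G = "complete_multipartite [1, 3]"
  define f :: "nat \<times> nat \<Rightarrow> nat" where
    "f p = (if fst p = 0 then v else if snd p = 0 then x else if snd p = 1 then y else z)" for p
  have V: "verts ?G = {(0, 0), (1, 0), (1, 1), (1, 2)}"
    by (auto simp: complete_multipartite_def Let_def less_Suc_eq numeral_3_eq_3 numeral_2_eq_2)
  \<comment> \<open>Inclusion suffices, since injectivity of \<open>c\<close> passes to subsets of
    the edge set.\<close>
  have E: "edges ?G \<subseteq> {{(0, 0), (1, 0)}, {(0, 0), (1, 1)}, {(0, 0), (1, 2)}}"
  proof
    fix e assume "e \<in> edges ?G"
    then obtain p q where "e = {p, q}" "p \<in> verts ?G" "q \<in> verts ?G" "fst p \<noteq> fst q"
      by (auto simp: complete_multipartite_def Let_def)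
    then show "e \<in> {{(0, 0), (1, 0)}, {(0, 0), (1, 1)}, {(0, 0), (1, 2)}}"
      unfolding V by (elim insertE emptyE) (simp_all add: insert_commute)
  qed
  \<comment> \<open>The leaves differ because their edges to \<open>v\<close> have different
    colors.\<close>
  have ne: "x \<noteq> y" "x \<noteq> z" "y \<noteq> z" using assms by auto
  have "inj_on f (verts ?G)"
    unfolding V using assms(5) ne by (auto simp: inj_on_def f_def)
  moreover have "f ` verts ?G \<subseteq> {..<n}"
    unfolding V using assms by (auto simp: f_def)
  moreover have "subgraph ?G ?G" "isomorphic ?G ?G"
    using simple_complete_multipartite by (auto simp: subgraph_def isomorphic_def intro!: exI[of _ id])
  ultimately obtain T where T: "subgraph T (complete_graph n)" "isomorphic T ?G"
    "edges T \<subseteq> (`) f ` edges ?G" by (metis embedded_copy)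
  have sub: "edges T \<subseteq> {{v, x}, {v, y}, {v, z}}"
  proof -
    have "(`) f ` {{(0, 0), (1, 0)}, {(0, 0), (1, 1)}, {(0, 0), (1, 2)}} = {{v, x}, {v, y}, {v, z}}"
      by (simp add: f_def insert_commute[of v])
    from this subset_trans[OF T(3) image_mono[OF E]] show ?thesis by (rule subst)
  qed
  have "inj_on c {{v, x}, {v, y}, {v, z}}"
    using assms by (auto simp: inj_on_def)
  then have "rainbow c T" unfolding rainbow_def using sub by (rule inj_on_subset)
  then show ?thesis using T by blast
qed

text \<open>Without a common element, a first pair, a member avoiding one of its points and a member
  avoiding the other form a triangle, and the triangle confines all members to its three corners.
  The sides of a triangle show that the bound 3 cannot be lowered.\<close>

lemma pairwise_intersecting_common:
  assumes "finite A" "\<And>X. X \<in> A \<Longrightarrow> finite X \<and> card X \<le> 2"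
    and meet: "\<And>X Y. X \<in> A \<Longrightarrow> Y \<in> A \<Longrightarrow> X \<inter> Y \<noteq> {}"
    and big: "card (\<Union>A) > 3"
  obtains i where "\<And>X. X \<in> A \<Longrightarrow> i \<in> X"
proof (rule ccontr)
  assume "\<not> thesis"
  then have none: "\<exists>X\<in>A. i \<notin> X" for i using that by blast
  \<comment> \<open>The empty set does not meet itself, and the point of a singleton member would
    lie in every member.\<close>
  have two: "\<exists>x y. x \<noteq> y \<and> X = {x, y}" if X: "X \<in> A" for X
  proof (rule ccontr)
    assume *: "\<not> ?thesis"
    have "card X \<noteq> 2" using * by (auto simp: card_2_iff)
    moreover have "card X \<noteq> 0" using assms(2) meet X by fastforce
    ultimately have "card X = 1" using assms(2)[OF X] by linarith
    then obtain x where "X = {x}" using card_1_singletonE by blast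
    then show False using none[of x] meet X by blast
  qed
  have "A \<noteq> {}" using big by auto
  then obtain x y where A1: "{x, y} \<in> A" "x \<noteq> y" using two by blast
  obtain B where B: "B \<in> A" "x \<notin> B" using none by blast
  have "y \<in> B" using meet[OF A1(1) B(1)] B(2) by auto
  then obtain z where z: "B = {y, z}" "z \<noteq> y" using two[OF B(1)] by auto
  obtain D where D: "D \<in> A" "y \<notin> D" using none by blast
  have xD: "x \<in> D" using meet[OF A1(1) D(1)] D(2) by auto
  have zD: "z \<in> D" using meet[OF B(1) D(1)] D(2) z by auto
  \<comment> \<open>A set with at most one corner misses the side opposite to it. So
    \<open>X\<close> contains two corners, and it has only two elements.\<close>
  have "X \<subseteq> {x, y, z}" if X: "X \<in> A" for X
  proof -
    obtain p q where "p \<noteq> q" "X = {p, q}" using two[OF X] by blast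
    moreover have "D = {x, z}" using two[OF D(1)] xD zD B(2) z by auto
    ultimately show ?thesis
      using meet[OF X A1(1)] meet[OF X B(1)] meet[OF X D(1)] z A1 B(2) by auto
  qed
  then have "\<Union>A \<subseteq> {x, y, z}" by blast
  then have "card (\<Union>A) \<le> card {x, y, z}" by (intro card_mono) auto
  also have "\<dots> \<le> 3" by (simp add: card_insert_if)
  finally show False using big by simp
qed

lemma monochromatic_multipartite:
  assumes k: "k \<ge> 4" and ex: "exact_edge_coloring k (complete_graph n) c"
    and nr: "\<not> (\<exists>S. subgraph S (complete_graph n) \<and>
      isomorphic S (complete_multipartite [1, 3]) \<and> rainbow c S)"
  obtains f i where "inj_on f (verts (complete_multipartite (replicate (k - 1) 2)))"
    and "f ` verts (complete_multipartite (replicate (k - 1) 2)) \<subseteq> {..<n}"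
    and "\<And>e. e \<in> edges (complete_multipartite (replicate (k - 1) 2)) \<Longrightarrow> c (f ` e) = i"
proof -
  \<comment> \<open>The colors seen at \<open>v\<close>; removing \<open>v\<close> itself keeps the
    non-edge \<open>{v, v}\<close> out.\<close>
  define C where "C v = (\<lambda>w. c {v, w}) ` ({..<n} - {v})" for v
  have colors: "c ` {e. e \<subseteq> {..<n} \<and> card e = 2} = {1..k}"
    using ex by (simp add: exact_edge_coloring_def complete_graph_def)
  have edge: "\<exists>a b. a < n \<and> b < n \<and> a \<noteq> b \<and> c {a, b} = j" if "j \<in> {1..k}" for j
  proof -
    have "j \<in> c ` {e. e \<subseteq> {..<n} \<and> card e = 2}" using that by (simp only: colors)
    then obtain e where "e \<subseteq> {..<n}" "card e = 2" "c e = j" by blast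
    then show ?thesis by (auto simp: card_2_iff)
  qed
  have inC: "c {v, w} \<in> C v" "c {v, w} \<in> C w" if "v < n" "w < n" "v \<noteq> w" for v w
  proof -
    show "c {v, w} \<in> C v" using that by (auto simp: C_def)
    have "c {w, v} \<in> C w" using that unfolding C_def by blast
    then show "c {v, w} \<in> C w" by (simp add: insert_commute)
  qed
  have C2: "finite (C v) \<and> card (C v) \<le> 2" if v: "v < n" for v
  proof
    show "finite (C v)" by (simp add: C_def)
    show "card (C v) \<le> 2"
    proof (rule ccontr)
      assume "\<not> card (C v) \<le> 2"
      then obtain T where "T \<subseteq> C v" "card T = 3"
        using obtain_subset_with_card_n[of 3 "C v"] by auto
      then obtain p q r where pqr: "p \<in> C v" "q \<in> C v" "r \<in> C v" "p \<noteq> q" "p \<noteq> r" "q \<noteq> r"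
        by (auto simp: card_3_iff)
      then obtain x y z where "x < n" "y < n" "z < n" "v \<notin> {x, y, z}"
        "p = c {v, x}" "q = c {v, y}" "r = c {v, z}" by (auto simp: C_def)
      then show False using rainbow_star[of v n x y z c] v pqr nr by auto
    qed
  qed
  have n2: "n \<ge> 2" using edge[of 1] k by auto
  have meet: "C v \<inter> C w \<noteq> {}" if "v < n" "w < n" for v w
  proof (cases "v = w")
    case True
    \<comment> \<open>Here the claim is that \<open>C v\<close> is non-empty, which requires a
      second vertex.\<close>
    obtain u where "u < n" "u \<noteq> v" using n2
      by (metis One_nat_def Suc_1 Suc_le_lessD less_trans zero_less_one zero_neq_one)
    then show ?thesis using inC(1)[of v u] that True by auto
  next
    case False
    then show ?thesis using inC[of v w] that by auto
  qed
  have "{1..k} \<subseteq> \<Union>(C ` {..<n})"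
  proof
    fix j assume "j \<in> {1..k}"
    then obtain a b where "a < n" "b < n" "a \<noteq> b" "c {a, b} = j" using edge by blast
    then show "j \<in> \<Union>(C ` {..<n})" using inC(1) by blast
  qed
  moreover have "finite (\<Union>(C ` {..<n}))" by (simp add: C_def)
  ultimately have "card {1..k} \<le> card (\<Union>(C ` {..<n}))" by (intro card_mono)
  \<comment> \<open>Here \<open>k \<ge> 4\<close> is decisive: with three colors the color sets
    could form a triangle.\<close>
  then have "card (\<Union>(C ` {..<n})) > 3" using k by simp
  then obtain i where i: "\<And>v. v < n \<Longrightarrow> i \<in> C v"
    using pairwise_intersecting_common[of "C ` {..<n}"] C2 meet
    by (smt (verit, best) finite_imageI finite_lessThan imageE image_eqI lessThan_iff)
  \<comment> \<open>The common color is one of the \<open>k\<close>, so exactly \<open>k - 1\<close>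
    others remain, one for each part of the multipartite graph.\<close>
  have "i \<in> {1..k}"
  proof -
    have "i \<in> C 0" using i n2 by auto
    then obtain w where "w < n" "w \<noteq> 0" "i = c {0, w}" by (auto simp: C_def)
    moreover have "{0, w} \<in> {e. e \<subseteq> {..<n} \<and> card e = 2}"
      using n2 calculation by auto
    ultimately show ?thesis using colors by blast
  qed
  then have "card ({1..k} - {i}) = k - 1" by simp
  then obtain h where h: "bij_betw h {..<k - 1} ({1..k} - {i})"
    by (metis bij_betw_iff_card card_lessThan finite_Diff finite_atLeastAtMost finite_lessThan)
  obtain a b where ab: "\<And>j. j \<in> {1..k} \<Longrightarrow> a j < n \<and> b j < n \<and> a j \<noteq> b j \<and> c {a j, b j} = j"
    using edge by metis
  have Ci: "C v = {i, j}" if "v < n" "j \<in> C v" "j \<noteq> i" for v j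
  proof (rule sym, rule card_seteq)
    show "card (C v) \<le> card {i, j}" using C2[of v] that by simp
  qed (use that i C2 in auto)
  \<comment> \<open>Both ends of the chosen edge of color \<open>j\<close> see \<open>i\<close> and
    \<open>j\<close>, and there is no room for a third color.\<close>
  have Cab: "C (a j) = {i, j}" "C (b j) = {i, j}" if "j \<in> {1..k} - {i}" for j
    using Ci[of "a j" j] Ci[of "b j" j] ab[of j] inC[of "a j" "b j"] that by auto
  \<comment> \<open>The two vertices of part \<open>t\<close> go to the two ends of the chosen edge
    of color \<open>h t\<close>.\<close>
  define f where "f p = (if snd p = 0 then a else b) (h (fst p))" for p :: "nat \<times> nat"
  let ?M = "complete_multipartite (replicate (k - 1) 2)"
  have V: "verts ?M = {..<k - 1} \<times> {..<2}"
    by (auto simp: complete_multipartite_def Let_def)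
  have hr: "h (fst p) \<in> {1..k} - {i}" if "p \<in> verts ?M" for p
    using bij_betwE[OF h] that unfolding V by auto
  have Cf: "C (f p) = {i, h (fst p)}" "f p < n" if "p \<in> verts ?M" for p
    using Cab[OF hr[OF that]] ab[of "h (fst p)"] hr[OF that] by (auto simp: f_def)
  have fst_eq: "fst p = fst q" if "p \<in> verts ?M" "q \<in> verts ?M" "h (fst p) = h (fst q)" for p q
    using that inj_onD[OF bij_betw_imp_inj_on[OF h]] unfolding V by auto
  \<comment> \<open>The color set of \<open>f p\<close> is \<open>{i, h (fst p)}\<close> with
    \<open>h (fst p)\<close> different from \<open>i\<close>, so it determines the part of
    \<open>p\<close>.\<close>
  have same: "fst p = fst q" if "p \<in> verts ?M" "q \<in> verts ?M" "f p = f q" for p q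
    using Cf[OF that(1)] Cf[OF that(2)] hr[OF that(1)] hr[OF that(2)] that
    by (intro fst_eq) (auto simp: doubleton_eq_iff)
  show thesis
  proof
    show "inj_on f (verts ?M)"
    proof
      fix p q assume p: "p \<in> verts ?M" and q: "q \<in> verts ?M" and eq: "f p = f q"
      have "a (h (fst p)) \<noteq> b (h (fst p))" using ab hr[OF p] by auto
      then have "snd p = 0 \<longleftrightarrow> snd q = 0"
        using eq same[OF p q eq] by (auto simp: f_def split: if_splits)
      then have "snd p = snd q" using p q unfolding V by auto
      then show "p = q" using same[OF p q eq] by (simp add: prod_eq_iff)
    qed
    show "f ` verts ?M \<subseteq> {..<n}" using Cf by auto
    fix e assume "e \<in> edges ?M"
    then obtain p q where e: "e = {p, q}" and p: "p \<in> verts ?M" and q: "q \<in> verts ?M"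
      and pq: "fst p \<noteq> fst q"
      by (auto simp: complete_multipartite_def Let_def)
    \<comment> \<open>The color of an edge is seen at both ends, and color sets belonging to
      different parts share only \<open>i\<close>.\<close>
    have "c {f p, f q} \<in> C (f p) \<inter> C (f q)"
      using inC[of "f p" "f q"] Cf p q same pq by blast
    then have "c {f p, f q} \<in> {i, h (fst p)} \<inter> {i, h (fst q)}"
      unfolding Cf(1)[OF p] Cf(1)[OF q] .
    moreover have "h (fst p) \<noteq> h (fst q)" using fst_eq p q pq by blast
    ultimately show "c (f ` e) = i" by (auto simp: e)
  qed
qed

section \<open>The smallest complete graph with at least \<open>k\<close> edges\<close>

lemma exact_edge_coloring_complete_graph_iff:
  assumes "k > 0"
  shows "(\<exists>c. exact_edge_coloring k (complete_graph n) c) \<longleftrightarrow> k \<le> n choose 2"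
proof -
  let ?E = "{e. e \<subseteq> {..<n} \<and> card e = 2}"
  have fin: "finite ?E" by simp
  have card: "card ?E = n choose 2" using n_subsets[of "{..<n}" 2] by simp
  show ?thesis
  proof
    assume "\<exists>c. exact_edge_coloring k (complete_graph n) c"
    then obtain c where "c ` ?E = {1..k}"
      by (auto simp: exact_edge_coloring_def complete_graph_def)
    then show "k \<le> n choose 2" using card_image_le[OF fin, of c] card by simp
  next
    assume "k \<le> n choose 2"
    obtain h where "bij_betw h ?E {0..<n choose 2}"
      using ex_bij_betw_finite_nat[OF fin] card by metis
    then have h: "h ` ?E = {0..<n choose 2}" by (rule bij_betw_imp_surj_on)
    \<comment> \<open>In an enumeration of the edges, the first \<open>k - 1\<close> get colors of
      their own and all later ones get color \<open>k\<close>.\<close>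
    have "(\<lambda>m. min (Suc m) k) ` {0..<n choose 2} = {1..k}"
    proof (intro equalityI subsetI)
      fix j assume "j \<in> {1..k}"
      then have "j = min (Suc (j - 1)) k" "j - 1 \<in> {0..<n choose 2}"
        using \<open>k \<le> n choose 2\<close> by auto
      then show "j \<in> (\<lambda>m. min (Suc m) k) ` {0..<n choose 2}" by blast
    qed (use assms in auto)
    then have "(\<lambda>m. min (Suc m) k) ` h ` ?E = {1..k}" unfolding h .
    then have "(\<lambda>e. min (Suc (h e)) k) ` ?E = {1..k}" unfolding image_image .
    then show "\<exists>c. exact_edge_coloring k (complete_graph n) c"
      by (auto simp: exact_edge_coloring_def complete_graph_def)
  qed
qed

text \<open>Completing the square turns \<open>2 * k \<le> n * (n - 1)\<close> into
  \<open>1 + 8 * k \<le> (2 * n - 1)^2\<close>. Setting \<open>n = 0\<close> apart makes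
  \<open>2 * n - 1\<close> nonnegative when the root is taken.\<close>

lemma le_choose_two_iff:
  assumes "k > 0"
  shows "k \<le> n choose 2 \<longleftrightarrow> \<lceil>(1 + sqrt (1 + 8 * real k)) / 2\<rceil> \<le> int n"
proof (cases "n = 0")
  case True
  have "(1 + sqrt (1 + 8 * real k)) / 2 > 0" by (simp add: add_pos_nonneg)
  then have "\<lceil>(1 + sqrt (1 + 8 * real k)) / 2\<rceil> > 0" by (simp only: zero_less_ceiling)
  then have "\<not> \<lceil>(1 + sqrt (1 + 8 * real k)) / 2\<rceil> \<le> int 0" by linarith
  then show ?thesis using True assms by (simp only: binomial_eq_0) simp
next
  case False
  have prod: "real n * (real n - 1) = real (n * (n - 1))" using False by (simp add: of_nat_diff)
  have "even (n * (n - 1))" by auto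
  then have "k \<le> n choose 2 \<longleftrightarrow> 2 * k \<le> n * (n - 1)" by (auto simp: choose_two)
  also have "\<dots> \<longleftrightarrow> 2 * real k \<le> real n * (real n - 1)"
    unfolding prod of_nat_le_iff[where 'a = real, symmetric] by simp
  also have "\<dots> \<longleftrightarrow> 1 + 8 * real k \<le> (2 * real n - 1)\<^sup>2"
  proof -
    have "(2 * real n - 1)\<^sup>2 = 4 * (real n * (real n - 1)) + 1"
      by (simp add: power2_eq_square algebra_simps)
    then show ?thesis by linarith
  qed
  also have "\<dots> \<longleftrightarrow> sqrt (1 + 8 * real k) \<le> 2 * real n - 1"
    using False by (auto intro: real_le_lsqrt dest: sqrt_le_D)
  also have "\<dots> \<longleftrightarrow> \<lceil>(1 + sqrt (1 + 8 * real k)) / 2\<rceil> \<le> int n"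
    by (simp add: ceiling_le_iff field_simps)
  finally show ?thesis .
qed

theorem theorem3p1:
  fixes k :: nat and H :: "'a ugraph"
  assumes "k \<ge> 4"
    and "simple_graph H" and "edges H \<noteq> {}" and "no_isolated_vertices H"
    and "\<exists>S. subgraph S (complete_multipartite (replicate (k - 1) 2)) \<and> isomorphic S H"
  shows "int (gallai_ramsey k (complete_multipartite [1, 3]) H)
           = \<lceil>(1 + sqrt (1 + 8 * real k)) / 2\<rceil>"
proof -
  define r where "r = \<lceil>(1 + sqrt (1 + 8 * real k)) / 2\<rceil>"
  have "r \<ge> 0"
  proof -
    have "(1 + sqrt (1 + 8 * real k)) / 2 > 0" by (simp add: add_pos_nonneg)
    then show ?thesis unfolding r_def by linarith
  qed
  have col: "(\<exists>c. exact_edge_coloring k (complete_graph n) c) \<longleftrightarrow> nat r \<le> n" for n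
    using exact_edge_coloring_complete_graph_iff[of k n] le_choose_two_iff[of k n] assms(1)
    by (simp add: r_def nat_le_iff)
  have mono: "\<exists>S. subgraph S (complete_graph n) \<and> isomorphic S H \<and> monochromatic c S"
    if c: "exact_edge_coloring k (complete_graph n) c"
      and nr: "\<not> (\<exists>S. subgraph S (complete_graph n) \<and>
        isomorphic S (complete_multipartite [1, 3]) \<and> rainbow c S)" for n c
  proof -
    let ?M = "complete_multipartite (replicate (k - 1) 2)"
    obtain f i where f: "inj_on f (verts ?M)" "f ` verts ?M \<subseteq> {..<n}"
      "\<And>e. e \<in> edges ?M \<Longrightarrow> c (f ` e) = i"
      using monochromatic_multipartite[OF assms(1) c nr] by metis
    obtain S where S: "subgraph S ?M" "isomorphic S H" using assms(5) by blast
    obtain T where "subgraph T (complete_graph n)" "isomorphic T H"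
      "edges T \<subseteq> (`) f ` edges ?M"
      using embedded_copy[OF S f(1,2)] .
    moreover from this f(3) have "monochromatic c T" unfolding monochromatic_def by blast
    ultimately show ?thesis by blast
  qed
  \<comment> \<open>By \<open>mono\<close> the Ramsey alternative holds for every \<open>n\<close>,
    so only the existence of an exact coloring, which \<open>col\<close> equates with
    \<open>nat r \<le> n\<close>, limits \<open>N\<close>.\<close>
  have "gallai_ramsey k (complete_multipartite [1, 3]) H = nat r"
    unfolding gallai_ramsey_def
    by (rule Least_equality) (use col mono in blast)+
  then show ?thesis using \<open>r \<ge> 0\<close> by (simp add: r_def)
qed

end
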